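(* Let $H$ and $K$ be complex inner product spaces with $\dim(H)\ge 2$, and let $A:H\to K$ be a non-zero additive mapping preserving Euclidean orthogonality. Then the following statements are equivalent: (a) $A$ is complex-linear or conjugate-linear. (b) For every $z\in H$ we have $A(iz)\in\{iA(z),-iA(z)\}$. (c) There exists a non-zero point $z\in H$ such that $A(iz)\in\{iA(z),-iA(z)\}$. (d) There exists a non-zero point $z\in H$ such that $iA(z)\in A(H)$. Furthermore, $A$ is neither complex-linear nor conjugate-linear if, and only if, there exists a non-zero $x\in H$ such that $iA(x)\notin A(H)$; equivalently, if, and only if, for every non-zero $x\in H$ we have $iA(x)\notin A(H)$.
   Context: Inner product spaces are not assumed complete or finite dimensional. A mapping $A:H\to K$ is additive if $A(x+y)=A(x)+A(y)$ for all $x,y\in H$ (no homogeneity or continuity is assumed). It preserves (Euclidean) orthogonality if $\langle x|y\rangle=0$ in $H$ implies $\langle A(x)|A(y)\rangle=0$ in $K$, for all $x,y\in H$. Here $\dim(H)$ is the complex dimension. *)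

theory Defs
  imports Complex_Main "HOL-Library.Extended_Nat"
begin

text \<open>
  The inner product is linear in its first argument and conjugate-linear in its second.
  Neither completeness nor finite dimension is assumed. The axiom \<open>ip_commute\<close> forces
  \<open>ip x x\<close> to be real, so nonnegativity only has to be required of its real part.
\<close>

locale complex_inner_product_space = vector_space scale
  for scale :: "complex \<Rightarrow> 'a::ab_group_add \<Rightarrow> 'a" +
  fixes ip :: "'a \<Rightarrow> 'a \<Rightarrow> complex"
  assumes ip_add_left: "ip (x + y) z = ip x z + ip y z"
    and ip_scale_left: "ip (scale c x) y = c * ip x y"
    and ip_commute: "ip y x = cnj (ip x y)"
    and ip_nonneg: "0 \<le> Re (ip x x)"
    and ip_eq_zero_iff: "ip x x = 0 \<longleftrightarrow> x = 0"

text \<open>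
  The library's \<open>vector_space.dim\<close> is natural-valued and returns \<open>0\<close> on spaces of infinite
  dimension; here such spaces get dimension \<open>\<infinity>\<close>.
\<close>

definition complex_dim :: "(complex \<Rightarrow> 'a::ab_group_add \<Rightarrow> 'a) \<Rightarrow> enat" where
  "complex_dim scale =
     (if \<exists>B. finite B \<and> module.span scale B = UNIV
      then enat (vector_space.dim scale UNIV) else \<infinity>)"

definition conjugate_linear ::
  "(complex \<Rightarrow> 'a::ab_group_add \<Rightarrow> 'a) \<Rightarrow> (complex \<Rightarrow> 'b::ab_group_add \<Rightarrow> 'b) \<Rightarrow> ('a \<Rightarrow> 'b) \<Rightarrow> bool"
  where
  "conjugate_linear scaleH scaleK A \<longleftrightarrow>
     additive A \<and> (\<forall>c x. A (scaleH c x) = scaleK (cnj c) (A x))"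

definition preserves_orthogonality ::
  "('a \<Rightarrow> 'a \<Rightarrow> complex) \<Rightarrow> ('b \<Rightarrow> 'b \<Rightarrow> complex) \<Rightarrow> ('a \<Rightarrow> 'b) \<Rightarrow> bool"
  where
  "preserves_orthogonality ipH ipK A \<longleftrightarrow> (\<forall>x y. ipH x y = 0 \<longrightarrow> ipK (A x) (A y) = 0)"

end

theory Submission
  imports Defs
begin

text \<open>
  Everything follows from one formula: there are constants \<open>m > 0\<close> and \<open>s\<close> such that
  \<open>\<langle>A u | A v\<rangle> = m * (Re \<langle>u | v\<rangle> + i * s * Im \<langle>u | v\<rangle>)\<close> for all \<open>u\<close>, \<open>v\<close>.

  To see it, put \<open>F x a = \<langle>A (a x) | A x\<rangle>\<close> and take \<open>y\<close> orthogonal to \<open>x\<close> and of the same norm,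
  which exists because the dimension is at least two. For all scalars \<open>a\<close>, \<open>c\<close> the vectors
  \<open>a x + (a * cnj c) y\<close> and \<open>c x - y\<close> are orthogonal, hence so are their images; this says
  \<open>\<langle>A (a x) | A (c x)\<rangle> = F y (a * cnj c)\<close>. So the left-hand side depends on \<open>a * cnj c\<close> only
  (lemma \<open>ip_image_multiples\<close>) and \<open>F x = F y\<close>. Now \<open>F x (r\<^sup>2) = \<langle>A (r x) | A (r x)\<rangle> \<ge> 0\<close>,
  and an additive function that is nonnegative on the nonnegative reals is linear there. This
  makes \<open>A\<close> real-homogeneous (lemma \<open>real_homogeneous\<close>).
  Splitting a vector along a unit vector \<open>e\<close> and its complement shows
  \<open>F x a = \<langle>x | x\<rangle> * F e a\<close>, and splitting \<open>u\<close> along \<open>v\<close> and its complement gives the formula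
  (lemma \<open>ip_image_formula\<close>), with \<open>m = F e 1\<close> and \<open>i * m * s = F e i\<close>.

  In these terms \<open>A (i x) - s i A x\<close> has squared norm \<open>m (1 - s\<^sup>2) \<langle>x | x\<rangle>\<close>. Hence
  \<open>s\<^sup>2 \<le> 1\<close>, and if \<open>s\<^sup>2 = 1\<close> then \<open>A (i x) = s i A x\<close> for all \<open>x\<close>, so \<open>A\<close> is linear or
  conjugate-linear. Conversely, if \<open>i A z = A y\<close> for a single \<open>z \<noteq> 0\<close>, the formula evaluates the
  squared norm of \<open>y - s i z\<close> to \<open>(s\<^sup>2 - 1) \<langle>z | z\<rangle>\<close>, so \<open>s\<^sup>2 \<ge> 1\<close> (lemma
  \<open>s_squared_eq_1\<close>). All the equivalences reduce to this dichotomy.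
\<close>

section \<open>Inner products and additive functions\<close>

context complex_inner_product_space
begin

lemma ip_add_right: "ip x (y + z) = ip x y + ip x z"
  by (metis complex_cnj_add ip_add_left ip_commute)

lemma ip_scale_right: "ip x (scale c y) = cnj c * ip x y"
  by (metis complex_cnj_mult ip_scale_left ip_commute)

lemma ip_zero_left [simp]: "ip 0 x = 0"
  using ip_add_left[of 0 0 x] by simp

lemma ip_zero_right [simp]: "ip x 0 = 0"
  using ip_add_right[of x 0 0] by simp

lemma ip_diff_left: "ip (x - y) z = ip x z - ip y z"
  using ip_add_left[of "x - y" y z] by simp

lemma ip_diff_right: "ip x (y - z) = ip x y - ip x z"
  using ip_add_right[of x "y - z" z] by simp

lemmas ip_expand = ip_add_left ip_add_right ip_diff_left ip_diff_right ip_scale_left ip_scale_right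

lemma ip_self_real: "ip x x = complex_of_real (Re (ip x x))"
proof -
  have "Im (ip x x) = - Im (ip x x)"
    by (subst (1) ip_commute) simp
  then show ?thesis by (simp add: complex_eq_iff)
qed

lemma ip_self_pos: "x \<noteq> 0 \<Longrightarrow> 0 < Re (ip x x)"
  using ip_nonneg[of x] ip_eq_zero_iff[of x] ip_self_real[of x] by (metis of_real_0 order_le_less)

lemma ip_self_eq_0D: "Re (ip x x) = 0 \<Longrightarrow> x = 0"
  using ip_self_pos[of x] by force

lemma orthogonal_commute: "ip x y = 0 \<longleftrightarrow> ip y x = 0"
  by (metis complex_cnj_zero ip_commute)

lemma orthogonal_component:
  assumes "x \<noteq> 0"
  shows "ip (u - scale (ip u x / ip x x) x) x = 0"
  using assms ip_eq_zero_iff[of x] by (simp add: ip_diff_left ip_scale_left)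

text \<open>
  Two orthogonal nonzero vectors can be rescaled to equal norm. The case \<open>w = 0\<close> is allowed, so
  that the orthogonal component of an arbitrary vector can be fed in; then any \<open>y\<close> orthogonal
  to \<open>x\<close> will do, and it is the dimension that provides one.
\<close>
lemma orthogonal_same_norm:
  assumes "\<And>v. span {v} \<noteq> UNIV" and "x \<noteq> 0" and "ip w x = 0"
  obtains y b where "ip x y = 0" and "ip y y = ip x x" and "w = scale b y"
proof -
  have normalize: "\<exists>y b. ip x y = 0 \<and> ip y y = ip x x \<and> w' = scale b y"
    if "w' \<noteq> 0" "ip w' x = 0" for w'
  proof -
    define c where "c = sqrt (Re (ip x x) / Re (ip w' w'))"
    have "c \<noteq> 0"
      using ip_self_pos[OF \<open>x \<noteq> 0\<close>] ip_self_pos[OF that(1)] by (simp add: c_def)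
    have c2: "c * c * Re (ip w' w') = Re (ip x x)"
      using ip_self_pos[OF \<open>x \<noteq> 0\<close>] ip_self_pos[OF that(1)] by (simp add: c_def)
    let ?y = "scale (of_real c) w'"
    have "ip ?y ?y = of_real (c * c * Re (ip w' w'))"
      by (simp add: ip_expand mult.assoc flip: ip_self_real)
    then have "ip ?y ?y = ip x x"
      using c2 ip_self_real[of x] by simp
    moreover have "ip x ?y = 0"
      using that(2) orthogonal_commute[of x w'] by (simp add: ip_scale_right)
    moreover have "w' = scale (inverse (of_real c)) ?y"
      using \<open>c \<noteq> 0\<close> by simp
    ultimately show ?thesis by blast
  qed
  show thesis
  proof (cases "w = 0")
    case True
    obtain u where u: "u \<notin> span {x}"
      using assms(1) by blast
    let ?w = "u - scale (ip u x / ip x x) x"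
    have "?w \<noteq> 0"
    proof
      assume "?w = 0"
      then have "u = scale (ip u x / ip x x) x" by simp
      then show False using u span_base span_scale by (metis insertI1)
    qed
    then show thesis
      using normalize[of ?w] orthogonal_component[OF \<open>x \<noteq> 0\<close>] True that[of _ 0] by auto
  next
    case False
    then show thesis
      using normalize[of w] assms(3) that by blast
  qed
qed

lemma singleton_not_spanning:
  assumes "complex_dim scale \<ge> 2"
  shows "span {x} \<noteq> UNIV"
proof
  assume "span {x} = UNIV"
  then have "dim UNIV \<le> 1" and "complex_dim scale = enat (dim UNIV)"
    using dim_le_card[of UNIV "{x}"] by (auto simp: complex_dim_def intro!: exI[of _ "{x}"])
  moreover have "(2::enat) = enat 2" by (simp add: numeral_eq_enat)
  ultimately show False using assms by simp
qed

end

text \<open>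
  Multiplying \<open>r\<close> by a large \<open>n\<close> and rounding to the integer \<open>k\<close> below \<open>n * r\<close> traps both \<open>n * g r\<close>
  and \<open>n * r * g 1\<close> between \<open>k * g 1\<close> and \<open>(k + 1) * g 1\<close>, so their difference stays bounded
  as \<open>n\<close> grows.
\<close>
lemma additive_nonneg_imp_linear:
  fixes g :: "real \<Rightarrow> real"
  assumes "additive g" and nonneg: "\<And>r. 0 \<le> r \<Longrightarrow> 0 \<le> g r"
  shows "g r = r * g 1"
proof -
  interpret additive g by fact
  have mono: "g p \<le> g q" if "p \<le> q" for p q
    using nonneg[of "q - p"] that by (simp add: diff)
  have nat_mult: "g (of_nat n * p) = of_nat n * g p" for n p
    by (induction n) (simp_all add: zero add distrib_right)
  have int: "g (of_int k) = of_int k * g 1" for k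
  proof (cases k)
    case (nonneg n)
    then show ?thesis using nat_mult[of n 1] by simp
  next
    case (neg n)
    then have k: "real_of_int k = - (of_nat (Suc n) * 1)" by simp
    show ?thesis unfolding k minus nat_mult by (simp add: algebra_simps)
  qed
  have bound: "of_nat n * \<bar>g r - r * g 1\<bar> \<le> g 1" for n
  proof -
    define k where "k = \<lfloor>of_nat n * r\<rfloor>"
    have k: "of_int k \<le> of_nat n * r" "of_nat n * r \<le> of_int (k + 1)"
      unfolding k_def by linarith+
    have "of_int k * g 1 \<le> of_nat n * g r" "of_nat n * g r \<le> of_int (k + 1) * g 1"
      using mono[OF k(1)] mono[OF k(2)] by (simp_all only: int nat_mult)
    moreover have "of_int k * g 1 \<le> of_nat n * r * g 1"
      "of_nat n * r * g 1 \<le> of_int (k + 1) * g 1"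
      using k nonneg[of 1] by (simp_all only: mult_right_mono zero_le_one)
    ultimately have "\<bar>of_nat n * g r - of_nat n * r * g 1\<bar> \<le> g 1"
      by (simp add: algebra_simps abs_le_iff)
    then show ?thesis
      by (metis abs_mult abs_of_nat mult.assoc right_diff_distrib)
  qed
  have "\<not> 0 < \<bar>g r - r * g 1\<bar>"
  proof
    assume "0 < \<bar>g r - r * g 1\<bar>"
    then obtain n where "g 1 < of_nat n * \<bar>g r - r * g 1\<bar>"
      using ex_less_of_nat_mult by blast
    then show False using bound[of n] by simp
  qed
  then show ?thesis by simp
qed

section \<open>The inner product of two images\<close>

text \<open>
  Dimension at least two serves to find a vector outside the line through a given one, so it is
  recorded in that form.
\<close>
locale orthogonality_preserving_additive =
  H: complex_inner_product_space scaleH ipH + K: complex_inner_product_space scaleK ipK + additive A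
  for scaleH :: "complex \<Rightarrow> 'h::ab_group_add \<Rightarrow> 'h" and ipH
    and scaleK :: "complex \<Rightarrow> 'k::ab_group_add \<Rightarrow> 'k" and ipK
    and A :: "'h \<Rightarrow> 'k" +
  assumes dim_ge_2: "\<And>x. H.span {x} \<noteq> UNIV"
    and orthogonal_image: "\<And>x y. ipH x y = 0 \<Longrightarrow> ipK (A x) (A y) = 0"
begin

definition F :: "'h \<Rightarrow> complex \<Rightarrow> complex" where
  "F x a = ipK (A (scaleH a x)) (A x)"

lemma F_add: "F x (a + b) = F x a + F x b"
  by (simp add: F_def H.scale_left_distrib add K.ip_add_left)

text \<open>
  The vectors \<open>a x + (a * cnj c) y\<close> and \<open>c x - y\<close> are orthogonal. In the inner product of their
  images the mixed terms vanish, and the two others must cancel.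
\<close>
lemma ip_image_orthogonal_pair:
  assumes "ipH x y = 0" and "ipH y y = ipH x x"
  shows "ipK (A (scaleH a x)) (A (scaleH c x)) = F y (a * cnj c)"
proof -
  have yx: "ipH y x = 0"
    using assms(1) H.orthogonal_commute by blast
  have "ipH (scaleH a x + scaleH (a * cnj c) y) (scaleH c x - y) = 0"
    using assms yx by (simp add: H.ip_expand)
  then have "ipK (A (scaleH a x) + A (scaleH (a * cnj c) y)) (A (scaleH c x) - A y) = 0"
    using orthogonal_image by (simp flip: add diff)
  moreover have "ipK (A (scaleH a x)) (A y) = 0"
    "ipK (A (scaleH (a * cnj c) y)) (A (scaleH c x)) = 0"
    using assms(1) yx by (simp_all add: orthogonal_image H.ip_expand)
  ultimately show ?thesis by (simp add: K.ip_expand F_def)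
qed

lemma F_orthogonal_pair:
  assumes "ipH x y = 0" and "ipH y y = ipH x x"
  shows "F y a = F x a"
  using ip_image_orthogonal_pair[OF assms, of a 1] by (simp add: F_def)

lemma ip_image_multiples: "ipK (A (scaleH a x)) (A (scaleH c x)) = F x (a * cnj c)"
proof (cases "x = 0")
  case True
  then show ?thesis by (simp add: F_def zero)
next
  case False
  obtain y where y: "ipH x y = 0" "ipH y y = ipH x x"
    using H.orthogonal_same_norm[OF dim_ge_2 False, of 0] by auto
  then show ?thesis
    using ip_image_orthogonal_pair F_orthogonal_pair by simp
qed

lemma F_cnj: "F x (cnj a) = cnj (F x a)"
  using ip_image_multiples[of 1 x a] K.ip_commute[of "A x" "A (scaleH a x)"] by (simp add: F_def)

text \<open>A nonnegative real \<open>r\<close> is \<open>sqrt r * cnj (sqrt r)\<close>, so \<open>F x r\<close> is a squared norm.\<close>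
lemma F_of_real: "F x (of_real r) = of_real r * F x 1"
proof -
  have square: "F x (of_real p) = ipK (A (scaleH (sqrt p) x)) (A (scaleH (sqrt p) x))"
    if "0 \<le> p" for p
    using that by (simp add: ip_image_multiples flip: of_real_mult)
  have "additive (\<lambda>p. Re (F x (of_real p)))"
    by standard (simp add: F_add)
  moreover have "0 \<le> Re (F x (of_real p))" if "0 \<le> p" for p
    using square[OF that] K.ip_nonneg by simp
  ultimately have "Re (F x (of_real r)) = r * Re (F x (of_real 1))"
    by (rule additive_nonneg_imp_linear)
  moreover have "Im (F x (of_real p)) = 0" for p
    using F_cnj[of x "of_real p"] by (simp add: complex_eq_iff)
  from this[of r] this[of 1] have "Im (F x (of_real r)) = 0" "Im (F x 1) = 0" by simp_all
  ultimately show ?thesis by (simp add: complex_eq_iff)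
qed

text \<open>
  By the preceding values of \<open>F\<close>, the vector \<open>A (r x) - r A x\<close> has squared norm
  \<open>(r\<^sup>2 - 2 r r + r\<^sup>2) * F x 1\<close>.
\<close>
lemma real_homogeneous: "A (scaleH (of_real r) x) = scaleK (of_real r) (A x)"
proof -
  let ?d = "A (scaleH (of_real r) x) - scaleK (of_real r) (A x)"
  have "ipK (A (scaleH (of_real r) x)) (A (scaleH (of_real r) x)) = of_real (r * r) * F x 1"
    using ip_image_multiples[of "of_real r" x "of_real r"] F_of_real[of x "r * r"] by simp
  moreover have "ipK (A (scaleH (of_real r) x)) (A x) = of_real r * F x 1"
    using F_of_real[of x r] by (simp add: F_def)
  moreover have "ipK (A x) (A (scaleH (of_real r) x)) = of_real r * F x 1"
    using ip_image_multiples[of 1 x "of_real r"] F_of_real[of x r] by simp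
  moreover have "ipK (A x) (A x) = F x 1"
    by (simp add: F_def)
  ultimately have "ipK ?d ?d = 0"
    by (simp add: K.ip_expand)
  then show ?thesis using K.ip_eq_zero_iff by simp
qed

lemma image_scale:
  "A (scaleH c x) = scaleK (of_real (Re c)) (A x) + scaleK (of_real (Im c)) (A (scaleH \<i> x))"
proof -
  have "scaleH c x = scaleH (of_real (Re c)) x + scaleH (of_real (Im c)) (scaleH \<i> x)"
    using complex_eq[of c] by (simp add: mult.commute flip: H.scale_left_distrib)
  then show ?thesis by (simp only: add real_homogeneous)
qed

lemma F_real_scale: "F x (of_real r * a) = of_real r * F x a"
  using real_homogeneous[of r "scaleH a x"] by (simp add: F_def K.ip_scale_left)

text \<open>
  With \<open>x = p e + q y\<close>, where \<open>y\<close> is a unit vector orthogonal to \<open>e\<close>, the value \<open>F x a\<close> splits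
  into multiples \<open>\<bar>p\<bar>\<^sup>2\<close> and \<open>\<bar>q\<bar>\<^sup>2\<close> of \<open>F e a = F y a\<close>. So \<open>F\<close> depends on \<open>x\<close> only
  through its norm.
\<close>
lemma F_eq_unit:
  assumes "ipH e e = 1"
  shows "F x a = ipH x x * F e a"
proof -
  have "e \<noteq> 0" using assms by auto
  define p where "p = ipH x e"
  have "ipH (x - scaleH p e) e = 0"
    using H.orthogonal_component[OF \<open>e \<noteq> 0\<close>, of x] by (simp add: assms p_def)
  from H.orthogonal_same_norm[OF dim_ge_2 \<open>e \<noteq> 0\<close> this]
  obtain y q where y: "ipH e y = 0" "ipH y y = ipH e e" and "x - scaleH p e = scaleH q y"
    by blast
  then have x: "x = scaleH p e + scaleH q y" by (simp add: algebra_simps)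
  have ye: "ipH y e = 0"
    using y(1) H.orthogonal_commute by blast
  have cross: "ipK (A (scaleH b e)) (A (scaleH c y)) = 0"
    "ipK (A (scaleH b y)) (A (scaleH c e)) = 0" for b c
    using y(1) ye by (simp_all add: orthogonal_image H.ip_expand)
  have "F x a = ipK (A (scaleH (a * p) e) + A (scaleH (a * q) y)) (A (scaleH p e) + A (scaleH q y))"
    by (simp add: F_def x add H.scale_right_distrib)
  also have "\<dots> = F e (a * p * cnj p) + F y (a * q * cnj q)"
    by (simp add: K.ip_expand cross ip_image_multiples)
  also have "\<dots> = F e (of_real ((cmod p)\<^sup>2 + (cmod q)\<^sup>2) * a)"
    unfolding of_real_add complex_norm_square
    by (simp add: F_orthogonal_pair[OF y] algebra_simps flip: F_add)
  also have "\<dots> = of_real ((cmod p)\<^sup>2 + (cmod q)\<^sup>2) * F e a"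
    by (rule F_real_scale)
  also have "of_real ((cmod p)\<^sup>2 + (cmod q)\<^sup>2) = ipH x x"
    by (simp add: x H.ip_expand y ye assms complex_norm_square mult.commute del: of_real_power)
  finally show ?thesis .
qed

text \<open>
  The component of \<open>u\<close> orthogonal to \<open>v\<close> does not contribute to \<open>\<langle>A u | A v\<rangle>\<close>, which leaves
  \<open>F e \<langle>u | v\<rangle>\<close> for a unit vector \<open>e\<close>. The real-linear map \<open>F e\<close> is determined by its values
  at \<open>1\<close> and \<open>i\<close>: the first is a squared norm, and the second is purely imaginary since
  \<open>F e\<close> commutes with conjugation.
\<close>
lemma ip_image_formula:
  assumes "\<exists>x. A x \<noteq> 0"
  obtains m s :: real where "m > 0"
    and "\<And>u v. ipK (A u) (A v) = of_real m * Complex (Re (ipH u v)) (s * Im (ipH u v))"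
proof -
  obtain z where z: "A z \<noteq> 0" using assms by blast
  then have "z \<noteq> 0" using zero by auto
  define r where "r = 1 / sqrt (Re (ipH z z))"
  define e where "e = scaleH (of_real r) z"
  have "ipH e e = of_real (r * r * Re (ipH z z))"
    by (simp add: e_def H.ip_expand mult.assoc flip: H.ip_self_real)
  also have "r * r * Re (ipH z z) = 1"
    using H.ip_self_pos[OF \<open>z \<noteq> 0\<close>] by (simp add: r_def)
  also have "of_real 1 = (1::complex)" by simp
  finally have e: "ipH e e = 1" .
  define m where "m = Re (F e 1)"
  define s where "s = Im (F e \<i>) / m"
  have F1: "F e 1 = of_real m"
    using K.ip_self_real by (simp add: F_def m_def)
  \<comment> \<open>Otherwise every \<open>F x 1\<close>, the squared norm of \<open>A x\<close>, would vanish.\<close>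
  have "m \<noteq> 0"
    using F_eq_unit[OF e, of z 1] z K.ip_eq_zero_iff[of "A z"] F1 by (auto simp: F_def)
  then have "m > 0"
    using K.ip_nonneg[of "A e"] by (simp add: m_def F_def)
  have "F e (- \<i>) = - F e \<i>"
    using F_real_scale[of e "-1" \<i>] by simp
  then have Fi: "F e \<i> = of_real m * Complex 0 s"
    using F_cnj[of e \<i>] \<open>m \<noteq> 0\<close> by (simp add: s_def complex_eq_iff)
  have Fe: "F e a = of_real m * Complex (Re a) (s * Im a)" for a
  proof -
    have "F e a = F e (of_real (Re a) * 1 + of_real (Im a) * \<i>)"
      using complex_eq[of a] by (simp add: mult.commute)
    also have "\<dots> = of_real m * Complex (Re a) (s * Im a)"
      unfolding F_add F_real_scale F1 Fi by (simp add: complex_eq_iff)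
    finally show ?thesis .
  qed
  have "ipK (A u) (A v) = of_real m * Complex (Re (ipH u v)) (s * Im (ipH u v))" for u v
  proof (cases "v = 0")
    case True
    then show ?thesis by (simp add: zero complex_eq_iff)
  next
    case False
    define p where "p = ipH u v / ipH v v"
    have "ipK (A (u - scaleH p v)) (A v) = 0"
      using H.orthogonal_component[OF False, of u] by (simp add: orthogonal_image p_def)
    then have "ipK (A u) (A v) = F v p"
      by (simp add: diff K.ip_diff_left F_def)
    also have "\<dots> = ipH v v * F e p"
      by (rule F_eq_unit[OF e])
    also have "\<dots> = F e (ipH v v * p)"
      using F_real_scale[of e "Re (ipH v v)" p] H.ip_self_real[of v] by simp
    also have "ipH v v * p = ipH u v"
      using False H.ip_eq_zero_iff by (simp add: p_def)
    finally show ?thesis by (simp add: Fe)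
  qed
  with \<open>m > 0\<close> show thesis by (rule that)
qed

end

section \<open>Linearity is decided by one parameter\<close>

locale orthogonality_preserving_formula =
  orthogonality_preserving_additive scaleH ipH scaleK ipK A
  for scaleH :: "complex \<Rightarrow> 'h::ab_group_add \<Rightarrow> 'h" and ipH
    and scaleK :: "complex \<Rightarrow> 'k::ab_group_add \<Rightarrow> 'k" and ipK
    and A :: "'h \<Rightarrow> 'k" +
  fixes m s :: real
  assumes m_pos: "m > 0"
    and ip_image: "ipK (A u) (A v) = of_real m * Complex (Re (ipH u v)) (s * Im (ipH u v))"
begin

text \<open>
  The vector \<open>s i A x\<close> is the orthogonal projection of \<open>A (i x)\<close> to the line through \<open>A x\<close>, so
  this defect vanishes exactly when \<open>A (i x)\<close> lies on that line.
\<close>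
lemma norm_defect:
  defines "d x \<equiv> A (scaleH \<i> x) - scaleK (\<i> * of_real s) (A x)"
  shows "Re (ipK (d x) (d x)) = m * (1 - s\<^sup>2) * Re (ipH x x)"
proof -
  have "Im (ipH x x) = 0"
    using H.ip_self_real[of x] by (metis Im_complex_of_real)
  then show ?thesis
    by (simp add: d_def K.ip_expand ip_image H.ip_expand algebra_simps power2_eq_square)
qed

text \<open>
  The equation \<open>i A z = A y\<close> can only hold if \<open>y = s i z\<close>, which suggests computing the squared
  norm of \<open>y - s i z\<close>; as \<open>\<langle>y | y\<rangle> = \<langle>z | z\<rangle>\<close> and \<open>s * Im \<langle>y | z\<rangle> = \<langle>z | z\<rangle>\<close>, it is
  \<open>(s\<^sup>2 - 1) \<langle>z | z\<rangle>\<close>. Its sign and that of \<open>norm_defect\<close> bound \<open>s\<^sup>2\<close> from opposite sides.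
\<close>
lemma s_squared_eq_1:
  assumes "z \<noteq> 0" and y: "A y = scaleK \<i> (A z)"
  shows "s\<^sup>2 = 1"
proof -
  have z_pos: "0 < Re (ipH z z)" using assms(1) by (rule H.ip_self_pos)
  have real: "Im (ipH x x) = 0" for x
    using H.ip_self_real[of x] by (metis Im_complex_of_real)
  have yy: "ipK (A y) (A y) = ipK (A z) (A z)"
    by (simp add: y K.ip_expand)
  have yz: "ipK (A y) (A z) = \<i> * ipK (A z) (A z)"
    by (simp add: y K.ip_expand)
  have N: "Re (ipH y y) = Re (ipH z z)" "s * Im (ipH y z) = Re (ipH z z)"
    using yy yz m_pos by (simp_all add: ip_image real complex_eq_iff)
  have "Im (ipH z y) = - Im (ipH y z)"
    by (subst H.ip_commute) simp
  then have "Re (ipH (y - scaleH (\<i> * of_real s) z) (y - scaleH (\<i> * of_real s) z))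
      = Re (ipH y y) + s\<^sup>2 * Re (ipH z z) - 2 * (s * Im (ipH y z))"
    by (simp add: H.ip_expand real algebra_simps power2_eq_square)
  also have "\<dots> = (s\<^sup>2 - 1) * Re (ipH z z)"
    unfolding N by (simp add: algebra_simps)
  finally have "0 \<le> (s\<^sup>2 - 1) * Re (ipH z z)"
    using H.ip_nonneg by metis
  then have "1 \<le> s\<^sup>2"
    using z_pos by (simp add: zero_le_mult_iff)
  moreover have "0 \<le> m * (1 - s\<^sup>2) * Re (ipH z z)"
    using norm_defect[of z] K.ip_nonneg by metis
  then have "s\<^sup>2 \<le> 1"
    using z_pos m_pos by (simp add: zero_le_mult_iff)
  ultimately show ?thesis by simp
qed

lemma image_scale_i:
  assumes "s\<^sup>2 = 1"
  shows "A (scaleH \<i> x) = scaleK (\<i> * of_real s) (A x)"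
  using norm_defect[of x] K.ip_self_eq_0D[of "A (scaleH \<i> x) - scaleK (\<i> * of_real s) (A x)"] assms
  by simp

lemma linear_or_conjugate_linear:
  assumes "s\<^sup>2 = 1"
  shows "Vector_Spaces.linear scaleH scaleK A \<or> conjugate_linear scaleH scaleK A"
proof -
  have scale: "A (scaleH c x) = scaleK (Complex (Re c) (s * Im c)) (A x)" for c x
  proof -
    have "A (scaleH c x) = scaleK (of_real (Re c) + of_real (Im c) * (\<i> * of_real s)) (A x)"
      unfolding image_scale[of c x] image_scale_i[OF assms] by (simp add: K.scale_left_distrib)
    also have "of_real (Re c) + of_real (Im c) * (\<i> * of_real s) = Complex (Re c) (s * Im c)"
      by (simp add: complex_eq_iff)
    finally show ?thesis .
  qed
  from assms consider "s = 1" | "s = -1"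
    by (auto simp: power2_eq_1_iff)
  then show ?thesis
  proof cases
    case 1
    then have "Vector_Spaces.linear scaleH scaleK A"
      by unfold_locales (simp_all add: add scale)
    then show ?thesis ..
  next
    case 2
    moreover have "Complex (Re c) (- Im c) = cnj c" for c
      by (simp add: complex_eq_iff)
    ultimately have "conjugate_linear scaleH scaleK A"
      using additive_axioms by (simp add: conjugate_linear_def scale)
    then show ?thesis ..
  qed
qed

end

section \<open>The equivalences\<close>

lemma linear_or_conjugate_linear_imp_scale_i:
  assumes "Vector_Spaces.linear scaleH scaleK A \<or> conjugate_linear scaleH scaleK A"
    and "vector_space scaleK"
  shows "A (scaleH \<i> z) \<in> {scaleK \<i> (A z), - scaleK \<i> (A z)}"
proof -
  interpret K: vector_space scaleK by fact
  show ?thesis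
    using assms(1)
  proof
    assume "Vector_Spaces.linear scaleH scaleK A"
    then interpret Vector_Spaces.linear scaleH scaleK A .
    show ?thesis by (simp add: scale)
  next
    assume "conjugate_linear scaleH scaleK A"
    then show ?thesis by (simp add: conjugate_linear_def)
  qed
qed

theorem theorem2p8:
  fixes scaleH :: "complex \<Rightarrow> 'h::ab_group_add \<Rightarrow> 'h"
    and ipH :: "'h \<Rightarrow> 'h \<Rightarrow> complex"
    and scaleK :: "complex \<Rightarrow> 'k::ab_group_add \<Rightarrow> 'k"
    and ipK :: "'k \<Rightarrow> 'k \<Rightarrow> complex"
    and A :: "'h \<Rightarrow> 'k"
  assumes H: "complex_inner_product_space scaleH ipH"
    and K: "complex_inner_product_space scaleK ipK"
    and dim: "complex_dim scaleH \<ge> 2"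
    and A_nonzero: "A \<noteq> (\<lambda>x. 0)"
    and A_additive: "additive A"
    and A_orth: "preserves_orthogonality ipH ipK A"
  defines "a \<equiv> Vector_Spaces.linear scaleH scaleK A \<or> conjugate_linear scaleH scaleK A"
    and "b \<equiv> \<forall>z. A (scaleH \<i> z) \<in> {scaleK \<i> (A z), - scaleK \<i> (A z)}"
    and "c \<equiv> \<exists>z. z \<noteq> 0 \<and> A (scaleH \<i> z) \<in> {scaleK \<i> (A z), - scaleK \<i> (A z)}"
    and "d \<equiv> \<exists>z. z \<noteq> 0 \<and> scaleK \<i> (A z) \<in> range A"
  shows "(a \<longleftrightarrow> b) \<and> (b \<longleftrightarrow> c) \<and> (c \<longleftrightarrow> d) \<and>
    (\<not> Vector_Spaces.linear scaleH scaleK A \<and> \<not> conjugate_linear scaleH scaleK A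
       \<longleftrightarrow> (\<exists>x. x \<noteq> 0 \<and> scaleK \<i> (A x) \<notin> range A)) \<and>
    (\<not> Vector_Spaces.linear scaleH scaleK A \<and> \<not> conjugate_linear scaleH scaleK A
       \<longleftrightarrow> (\<forall>x. x \<noteq> 0 \<longrightarrow> scaleK \<i> (A x) \<notin> range A))"
proof -
  interpret H: complex_inner_product_space scaleH ipH by fact
  interpret K: complex_inner_product_space scaleK ipK by fact
  interpret orthogonality_preserving_additive scaleH ipH scaleK ipK A
  proof (intro_locales)
    show "additive A" by fact
    show "orthogonality_preserving_additive_axioms scaleH ipH ipK A"
      using H.singleton_not_spanning[OF dim] A_orth
      by unfold_locales (auto simp: preserves_orthogonality_def)
  qed
  obtain z\<^sub>0 where "A z\<^sub>0 \<noteq> 0" using A_nonzero by auto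
  then have "z\<^sub>0 \<noteq> 0" using zero by auto
  obtain m s :: real where "m > 0"
    and "\<And>u v. ipK (A u) (A v) = of_real m * Complex (Re (ipH u v)) (s * Im (ipH u v))"
    using ip_image_formula \<open>A z\<^sub>0 \<noteq> 0\<close> by blast
  then interpret orthogonality_preserving_formula scaleH ipH scaleK ipK A m s
    by unfold_locales
  have ab: "b" if "a"
    using that linear_or_conjugate_linear_imp_scale_i K.vector_space_axioms
    unfolding a_def b_def by blast
  have range: "scaleK \<i> (A z) \<in> range A"
    if "A (scaleH \<i> z) \<in> {scaleK \<i> (A z), - scaleK \<i> (A z)}" for z
  proof -
    have "scaleK \<i> (A z) = A (scaleH \<i> z) \<or> scaleK \<i> (A z) = A (- scaleH \<i> z)"
      using that by (auto simp: minus)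
    then show ?thesis by blast
  qed
  have da: "a" if "d"
  proof -
    from that obtain z y where "z \<noteq> 0" "A y = scaleK \<i> (A z)"
      unfolding d_def by (metis rangeE)
    then show ?thesis
      unfolding a_def by (intro linear_or_conjugate_linear s_squared_eq_1)
  qed
  have bc: "c" if "b"
    using that \<open>z\<^sub>0 \<noteq> 0\<close> unfolding b_def c_def by blast
  have cd: "d" if "c"
    using that range unfolding c_def d_def by blast
  have all_range: "scaleK \<i> (A x) \<in> range A" if "a" for x
    using range ab[OF that] unfolding b_def by blast
  have "\<not> a \<longleftrightarrow> (\<exists>x. x \<noteq> 0 \<and> scaleK \<i> (A x) \<notin> range A)"
    using all_range da \<open>z\<^sub>0 \<noteq> 0\<close> unfolding d_def by blast
  moreover have "\<not> a \<longleftrightarrow> (\<forall>x. x \<noteq> 0 \<longrightarrow> scaleK \<i> (A x) \<notin> range A)"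
    using all_range da \<open>z\<^sub>0 \<noteq> 0\<close> unfolding d_def by blast
  ultimately show ?thesis
    using ab bc cd da unfolding a_def by blast
qed

end
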